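(* Let $d\ge 2$ be an integer, let $\mu>0$, let $\boldsymbol{x}_0\in\mathbb{R}^d$ be fixed, and let $t>0$. Let $\mathcal{R}(\{\boldsymbol{x}_0\},t)\subset\mathbb{R}^d$ be the forward reach set at time $t$ of the $d$-dimensional integrator $\dot{\boldsymbol{x}}=\boldsymbol{A}\boldsymbol{x}+\boldsymbol{b}u$, $u\in[-\mu,\mu]$, started from $\boldsymbol{x}(0)=\boldsymbol{x}_0$. Let $$\boldsymbol{\xi}(s)=\left(\frac{s^{d-1}}{(d-1)!},\ \frac{s^{d-2}}{(d-2)!},\ \dots,\ s,\ 1\right)^{\top}\in\mathbb{R}^d,\qquad \boldsymbol{\zeta}(t)=\int_0^t\boldsymbol{\xi}(s)\,ds\in\mathbb{R}^d .$$ Then the diameter (maximal width) of the reach set is $$\mathrm{diam}\left(\mathcal{R}(\{\boldsymbol{x}_0\},t)\right)=2\mu\,\|\boldsymbol{\zeta}(t)\|_2=2\mu\left\{\sum_{j=1}^{d}\left(\frac{t^{j}}{j!}\right)^{2}\right\}^{1/2}.$$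
   Context: Integrator dynamics: $\boldsymbol{A}\in\mathbb{R}^{d\times d}$ is the matrix whose columns are $\boldsymbol{0},\boldsymbol{e}_1,\boldsymbol{e}_2,\dots,\boldsymbol{e}_{d-1}$ (the upper shift matrix), and $\boldsymbol{b}=\boldsymbol{e}_d$, where $\boldsymbol{e}_i$ is the $i$-th standard basis column vector of $\mathbb{R}^d$. Forward reach set: for an initial set $\mathcal{X}_0\subset\mathbb{R}^d$ and $t>0$, $\mathcal{R}(\mathcal{X}_0,t)$ is the set of all points $\boldsymbol{x}(t)\in\mathbb{R}^d$, where $\boldsymbol{x}(\cdot)$ solves $\dot{\boldsymbol{x}}=\boldsymbol{A}\boldsymbol{x}+\boldsymbol{b}u$ on $[0,t]$ with $\boldsymbol{x}(0)\in\mathcal{X}_0$ for some (measurable) control $u:[0,t]\to[-\mu,\mu]$. Equivalently, $\mathcal{R}(\{\boldsymbol{x}_0\},t)=\{\exp(t\boldsymbol{A})\boldsymbol{x}_0+\int_0^t\exp((t-\tau)\boldsymbol{A})\boldsymbol{b}\,u(\tau)\,d\tau \;:\; u:[0,t]\to[-\mu,\mu]\ \text{measurable}\}$. It is a compact convex set. Width and diameter: for a compact convex set $\mathcal{K}\subset\mathbb{R}^d$, the support function is $h_{\mathcal{K}}(\boldsymbol{y})=\sup_{\boldsymbol{x}\in\mathcal{K}}\langle\boldsymbol{y},\boldsymbol{x}\rangle$; the width in direction $\boldsymbol{\eta}\in\mathbb{S}^{d-1}$ (Euclidean unit sphere) is $w_{\mathcal{K}}(\boldsymbol{\eta})=h_{\mathcal{K}}(\boldsymbol{\eta})+h_{\mathcal{K}}(-\boldsymbol{\eta})$;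 and the diameter is $\mathrm{diam}(\mathcal{K})=\max_{\boldsymbol{\eta}\in\mathbb{S}^{d-1}}w_{\mathcal{K}}(\boldsymbol{\eta})$. *)

theory Defs
  imports "HOL-Analysis.Analysis"
begin

(* R^d is real^'n for an arbitrary finite linearly ordered index type 'n with CARD('n) = d;
   pos i is the 1-based position of the coordinate i, see bij_betw_pos. *)

definition pos :: "'n::{finite,linorder} \<Rightarrow> nat" where
  "pos i = card {..i}"

lemma strict_mono_pos: "strict_mono (pos :: 'n::{finite,linorder} \<Rightarrow> nat)"
proof (rule strict_monoI)
  fix i j :: 'n
  assume "i < j"
  then have "{..i} \<subset> {..j}" by auto
  then show "pos i < pos j" unfolding pos_def by (intro psubset_card_mono) auto
qed

lemma bij_betw_pos: "bij_betw pos (UNIV :: 'n::{finite,linorder} set) {1..CARD('n)}"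
proof -
  have inj: "inj (pos :: 'n \<Rightarrow> nat)"
    by (rule strict_mono_imp_inj_on[OF strict_mono_pos])
  have sub: "range (pos :: 'n \<Rightarrow> nat) \<subseteq> {1..CARD('n)}"
  proof (intro image_subsetI)
    fix i :: 'n
    have "card {..i} > 0" by (simp add: card_gt_0_iff)
    moreover have "card {..i} \<le> CARD('n)" by (intro card_mono) auto
    ultimately show "pos i \<in> {1..CARD('n)}" unfolding pos_def by auto
  qed
  have "range (pos :: 'n \<Rightarrow> nat) = {1..CARD('n)}"
    by (intro card_subset_eq sub) (simp_all add: card_image[OF inj])
  with inj show ?thesis by (simp add: bij_betw_def)
qed

definition std_basis :: "nat \<Rightarrow> real^'n::{finite,linorder}" where
  "std_basis k = (\<chi> i. if pos i = k then 1 else 0)"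

(* The vectors listed are the columns 0, e_1, ..., e_(d-1); transpose turns rows into columns. *)
definition integrator_A :: "real^'n::{finite,linorder}^'n::{finite,linorder}" where
  "integrator_A = transpose (\<chi> j. if pos j = 1 then 0 else std_basis (pos j - 1))"

definition integrator_b :: "real^'n::{finite,linorder}" where
  "integrator_b = std_basis CARD('n)"

definition admissible_control :: "real \<Rightarrow> real \<Rightarrow> (real \<Rightarrow> real) \<Rightarrow> bool" where
  "admissible_control \<mu> t u \<longleftrightarrow>
     u \<in> borel_measurable (lebesgue_on {0..t}) \<and> (\<forall>s\<in>{0..t}. u s \<in> {-\<mu>..\<mu>})"

(* For a merely measurable control, a solution of x' = A x + b u is understood in the sense of
   Caratheodory, i.e. as a solution of the integral equation
   x(s) = x(0) + \<integral>_0^s (A x(r) + b u(r)) dr  for all s in [0,t]. *)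
definition integrator_solution ::
    "real \<Rightarrow> (real \<Rightarrow> real) \<Rightarrow> (real \<Rightarrow> real^'n::{finite,linorder}) \<Rightarrow> bool" where
  "integrator_solution t u x \<longleftrightarrow> continuous_on {0..t} x \<and>
     (\<forall>s\<in>{0..t}. ((\<lambda>r. integrator_A *v x r + u r *\<^sub>R integrator_b) has_integral (x s - x 0)) {0..s})"

definition reach_set ::
    "real \<Rightarrow> (real^'n::{finite,linorder}) set \<Rightarrow> real \<Rightarrow> (real^'n::{finite,linorder}) set" where
  "reach_set \<mu> X\<^sub>0 t =
     {x t |x u. admissible_control \<mu> t u \<and> integrator_solution t u x \<and> x 0 \<in> X\<^sub>0}"

definition support_function :: "'a::euclidean_space set \<Rightarrow> 'a \<Rightarrow> real" where
  "support_function K y = (SUP x\<in>K. y \<bullet> x)"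

definition width :: "'a::euclidean_space set \<Rightarrow> 'a \<Rightarrow> real" where
  "width K \<eta> = support_function K \<eta> + support_function K (- \<eta>)"

(* Maximum over the unit sphere. Max is only meaningful for finite sets, hence GREATEST; unlike
   SUP, its value is determined only if the maximum is attained. *)
definition diam :: "'a::euclidean_space set \<Rightarrow> real" where
  "diam K = (GREATEST w. \<exists>\<eta>\<in>sphere 0 1. w = width K \<eta>)"

definition xi :: "real \<Rightarrow> real^'n::{finite,linorder}" where
  "xi s = (\<chi> i. s ^ (CARD('n) - pos i) / fact (CARD('n) - pos i))"

definition zeta :: "real \<Rightarrow> real^'n::{finite,linorder}" where
  "zeta t = integral {0..t} xi"

end

theory Submission
  imports Defs
begin

text \<open>The integrator is a monotone system: \<^term>\<open>integrator_A\<close> and \<^term>\<open>integrator_b\<close> have nonnegative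
  entries, and each coordinate is driven only by the next one, so a larger control gives coordinatewise
  larger trajectories. Hence the reach set lies in the box whose extreme corners are the end points for
  the constant controls \<open>-\<mu>\<close> and \<open>\<mu>\<close>, and both corners are reached. The diameter of the reach set is
  therefore the length \<open>2 \<mu> \<parallel>\<zeta> t\<parallel>\<close> of the diagonal of the box.\<close>

text \<open>The width in direction \<eta> is the supremum of \<open>\<eta> \<bullet> (x - y)\<close>
  over \<open>x\<close>, \<open>y\<close> in \<open>K\<close>. By Cauchy-Schwarz it is at most the
  largest distance, and the unit vector along \<open>p - q\<close> attains this bound, which gives
  \<open>GREATEST\<close> its value.\<close>

lemma diam_eq_dist:
  fixes K :: "'a::euclidean_space set"
  assumes p: "p \<in> K" and q: "q \<in> K" and "p \<noteq> q"
    and far: "\<And>x y. x \<in> K \<Longrightarrow> y \<in> K \<Longrightarrow> dist x y \<le> dist p q"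
  shows "diam K = dist p q"
proof -
  \<comment> \<open>All of \<open>K\<close> lies within \<open>dist p q\<close> of \<open>p\<close>,
    so the suprema are those of bounded sets and \<open>cSUP_upper\<close> applies.\<close>
  have bdd: "bdd_above ((\<lambda>x. \<eta> \<bullet> x) ` K)" for \<eta>
  proof -
    have "bounded K"
      unfolding bounded_def using far[OF p] by blast
    then have "bounded ((\<lambda>x. \<eta> \<bullet> x) ` K)"
      by (rule bounded_linear_image) (rule bounded_linear_inner_right)
    then show ?thesis by (rule bounded_imp_bdd_above)
  qed
  have le: "width K \<eta> \<le> dist p q" if "norm \<eta> = 1" for \<eta>
  proof -
    have "\<eta> \<bullet> x + (- \<eta>) \<bullet> y \<le> dist p q" if "x \<in> K" "y \<in> K" for x y
    proof -
      have "\<eta> \<bullet> x + (- \<eta>) \<bullet> y = \<eta> \<bullet> (x - y)" by (simp add: inner_diff_right)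
      also have "\<dots> \<le> dist x y"
        using norm_cauchy_schwarz[of \<eta> "x - y"] \<open>norm \<eta> = 1\<close> by (simp add: dist_norm)
      finally show ?thesis using far[OF that] by linarith
    qed
    \<comment> \<open>The two suprema are taken one at a time: over \<open>x\<close> with
      \<open>y\<close> fixed, then over \<open>y\<close>.\<close>
    then have "support_function K \<eta> \<le> dist p q - (- \<eta>) \<bullet> y" if "y \<in> K" for y
      unfolding support_function_def using p that by (intro cSUP_least) fastforce+
    then have "support_function K (- \<eta>) \<le> dist p q - support_function K \<eta>"
      unfolding support_function_def[of K "- \<eta>"] using p by (intro cSUP_least) fastforce+
    then show ?thesis by (simp add: width_def)
  qed
  define \<eta> where "\<eta> = sgn (p - q)"
  have \<eta>: "norm \<eta> = 1" using \<open>p \<noteq> q\<close> by (simp add: \<eta>_def norm_sgn)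
  have "\<eta> \<bullet> p \<le> support_function K \<eta>" "(- \<eta>) \<bullet> q \<le> support_function K (- \<eta>)"
    unfolding support_function_def by (intro cSUP_upper p q bdd)+
  moreover have "\<eta> \<bullet> p + (- \<eta>) \<bullet> q = \<eta> \<bullet> (p - q)" by (simp add: inner_diff_right)
  moreover have "\<eta> \<bullet> (p - q) = dist p q"
    using \<open>p \<noteq> q\<close>
    by (simp add: \<eta>_def sgn_div_norm dist_norm power2_norm_eq_inner[symmetric] power2_eq_square)
  ultimately have "width K \<eta> \<ge> dist p q" by (simp add: width_def)
  with le[OF \<eta>] have "width K \<eta> = dist p q" by simp
  then show ?thesis
    unfolding diam_def using \<eta> le
    by (intro Greatest_equality) (auto intro!: bexI[of _ \<eta>])
qed

lemma integrator_A_nth: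
  "(integrator_A :: real^'n::{finite,linorder}^'n::{finite,linorder}) $ i $ j = (if pos j = Suc (pos i) then 1 else 0)"
proof -
  \<comment> \<open>Positions start at 1, so \<open>pos j - 1\<close> is a true predecessor whenever
    \<open>pos j\<close> is not 1, and \<open>pos j = Suc (pos i)\<close> rules out the zero
    column.\<close>
  have "pos i \<ge> 1" "pos j \<ge> 1"
    using bij_betw_apply[OF bij_betw_pos] by fastforce+
  then show ?thesis
    by (auto simp: integrator_A_def transpose_def std_basis_def)
qed

lemma integrator_b_nth:
  "(integrator_b :: real^'n::{finite,linorder}) $ i = (if pos i = CARD('n) then 1 else 0)"
  by (simp add: integrator_b_def std_basis_def)

lemma pos_le_card: "pos (i :: 'n::{finite,linorder}) \<le> CARD('n)"
  using bij_betw_apply[OF bij_betw_pos, of i] by simp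

text \<open>Induction from the last coordinate to the first: the integrand of a coordinate contains
  only the next coordinate, or the control for the last one, and integration preserves the order.
  The time \<open>s\<close> is generalised because the hypothesis is used at every \<open>r\<close>
  in \<open>{0..s}\<close>.\<close>

lemma integrator_solution_mono:
  fixes x y :: "real \<Rightarrow> real^'n::{finite,linorder}"
  assumes x: "integrator_solution t u x" and y: "integrator_solution t v y"
    and init: "\<And>i. x 0 $ i \<le> y 0 $ i"
    and uv: "\<And>s. s \<in> {0..t} \<Longrightarrow> u s \<le> v s"
    and "s \<in> {0..t}"
  shows "x s $ i \<le> y s $ i"
  using \<open>s \<in> {0..t}\<close>
proof (induction "CARD('n) - pos i" arbitrary: i s rule: less_induct)
  case less
  have comp: "((\<lambda>r. (integrator_A *v z r) $ i + w r * integrator_b $ i)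
      has_integral (z s $ i - z 0 $ i)) {0..s}"
    if "integrator_solution t w z" for w z
  proof -
    have "((\<lambda>r. integrator_A *v z r + w r *\<^sub>R integrator_b) has_integral (z s - z 0)) {0..s}"
      using that less.prems unfolding integrator_solution_def by blast
    from has_integral_linear[OF this bounded_linear_vec_nth[of i]] show ?thesis
      by (simp add: o_def)
  qed
  have "x s $ i - x 0 $ i \<le> y s $ i - y 0 $ i"
  proof (rule has_integral_le[OF comp[OF x] comp[OF y]])
    fix r assume "r \<in> {0..s}"
    then have r: "r \<in> {0..t}" using less.prems by auto
    have "(integrator_A *v x r) $ i \<le> (integrator_A *v y r) $ i"
      unfolding matrix_vector_mult_def vec_lambda_beta
    proof (rule sum_mono)
      fix j :: 'n
      show "integrator_A $ i $ j * x r $ j \<le> integrator_A $ i $ j * y r $ j"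
      proof (cases "pos j = Suc (pos i)")
        case True
        then have "CARD('n) - pos j < CARD('n) - pos i"
          using pos_le_card[of j] by linarith
        from less.hyps[OF this r] True show ?thesis
          by (simp add: integrator_A_nth)
      qed (simp add: integrator_A_nth)
    qed
    then show "(integrator_A *v x r) $ i + u r * integrator_b $ i
        \<le> (integrator_A *v y r) $ i + v r * integrator_b $ i"
      using uv[OF r] by (simp add: integrator_b_nth)
  qed
  with init[of i] show ?case by linarith
qed

lemma DERIV_power_div_fact:
  "((\<lambda>s::real. s ^ Suc k / fact (Suc k)) has_real_derivative s ^ k / fact k) (at s within S)"
  by (rule derivative_eq_intros refl | simp del: of_nat_Suc)+

text \<open>For \<open>m \<le> N\<close> these polynomials solve the chain f_m' = f_(m+1), with f_N
  constant and initial values \<open>a m\<close>.\<close>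

definition taylor_tail :: "nat \<Rightarrow> (nat \<Rightarrow> real) \<Rightarrow> nat \<Rightarrow> real \<Rightarrow> real" where
  "taylor_tail N a m s = (\<Sum>k\<le>N - m. s ^ k / fact k * a (m + k))"

lemma taylor_tail_0 [simp]: "taylor_tail N a m 0 = a m"
  by (simp add: taylor_tail_def power_0_left sum.atMost_shift)

lemma taylor_tail_self [simp]: "taylor_tail N a N s = a N"
  by (simp add: taylor_tail_def)

lemma DERIV_taylor_tail:
  assumes "m < N"
  shows "(taylor_tail N a m has_real_derivative taylor_tail N a (Suc m) s) (at s within S)"
proof -
  obtain n where n: "N - m = Suc n" "N - Suc m = n"
    using assms by (metis Suc_diff_Suc)
  \<comment> \<open>With the constant term split off, every remaining exponent is positive and drops
    by one under differentiation.\<close>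
  have "((\<lambda>s. a m + (\<Sum>k\<le>n. s ^ Suc k / fact (Suc k) * a (m + Suc k))) has_real_derivative
      0 + (\<Sum>k\<le>n. s ^ k / fact k * a (m + Suc k))) (at s within S)"
    by (intro DERIV_add DERIV_const DERIV_sum DERIV_cmult_right DERIV_power_div_fact)
  also have "0 + (\<Sum>k\<le>n. s ^ k / fact k * a (m + Suc k)) = taylor_tail N a (Suc m) s"
    unfolding taylor_tail_def n by simp
  also have "(\<lambda>s. a m + (\<Sum>k\<le>n. s ^ Suc k / fact (Suc k) * a (m + Suc k))) = taylor_tail N a m"
    unfolding taylor_tail_def n by (subst sum.atMost_Suc_shift) simp
  finally show ?thesis .
qed

text \<open>The constant control \<open>c\<close> plays the role of an additional last coordinate, at position
  \<open>CARD('n) + 1\<close>, so that all coordinates obey the same equation.\<close>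

definition extended_state :: "real \<Rightarrow> real^'n::{finite,linorder} \<Rightarrow> nat \<Rightarrow> real" where
  "extended_state c x m = (if m \<le> CARD('n) then x $ inv pos m else c)"

text \<open>The variation of constants formula for the control \<open>c\<close>, written out; it is
  polynomial in \<open>s\<close> because \<open>integrator_A\<close> is nilpotent.\<close>

definition const_trajectory :: "real \<Rightarrow> real^'n::{finite,linorder} \<Rightarrow> real \<Rightarrow> real^'n::{finite,linorder}" where
  "const_trajectory c x s =
     (\<chi> i. taylor_tail (Suc CARD('n)) (extended_state c x) (pos i) s)"

lemma const_trajectory_0 [simp]: "const_trajectory c x 0 = x"
  by (simp add: const_trajectory_def extended_state_def pos_le_card vec_eq_iff inv_f_f
      strict_mono_imp_inj_on[OF strict_mono_pos])

lemma integrator_solution_const_trajectory: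
  fixes x :: "real^'n::{finite,linorder}"
  shows "integrator_solution t (\<lambda>_. c) (const_trajectory c x)"
proof -
  let ?T = "taylor_tail (Suc CARD('n)) (extended_state c x)"
  have rhs: "integrator_A *v const_trajectory c x r + c *\<^sub>R integrator_b = (\<chi> i. ?T (Suc (pos i)) r)" for r
  proof -
    have "(integrator_A *v const_trajectory c x r) $ i
        = (if Suc (pos i) \<le> CARD('n) then ?T (Suc (pos i)) r else 0)" for i
    proof -
      have "(integrator_A *v const_trajectory c x r) $ i
          = (\<Sum>j\<in>UNIV. (if pos (j::'n) = Suc (pos i) then ?T (pos j) r else 0))"
        by (auto simp: matrix_vector_mult_def integrator_A_nth const_trajectory_def intro!: sum.cong)
      also have "\<dots> = (\<Sum>m\<in>{1..CARD('n)}. (if m = Suc (pos i) then ?T m r else 0))"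
        by (rule sum.reindex_bij_betw[OF bij_betw_pos])
      finally show ?thesis by simp
    qed
    \<comment> \<open>In the last row \<open>integrator_A\<close> contributes nothing, and the extra
      coordinate supplies the control term.\<close>
    moreover have "?T (Suc (pos i)) r = c" if "pos i = CARD('n)" for i :: 'n
      by (simp add: that extended_state_def)
    moreover have "pos i = CARD('n) \<or> Suc (pos i) \<le> CARD('n)" for i :: 'n
      using pos_le_card[of i] by linarith
    ultimately show ?thesis
      by (fastforce simp: vec_eq_iff integrator_b_nth)
  qed
  have deriv: "(const_trajectory c x has_vector_derivative
      (integrator_A *v const_trajectory c x r + c *\<^sub>R integrator_b)) (at r within S)" for r S
    unfolding rhs has_vector_derivative_def
    by (subst has_derivative_componentwise_within)
      (auto simp: Basis_vec_def inner_axis const_trajectory_def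
        has_field_derivative_def[symmetric] mult.commute[of _ "?T _ _"]
        intro!: DERIV_taylor_tail pos_le_card le_imp_less_Suc)
  show ?thesis
    unfolding integrator_solution_def
  proof (intro conjI ballI)
    show "continuous_on {0..t} (const_trajectory c x)"
      using deriv by (rule continuous_on_vector_derivative)
    show "((\<lambda>r. integrator_A *v const_trajectory c x r + c *\<^sub>R integrator_b) has_integral
        (const_trajectory c x s - const_trajectory c x 0)) {0..s}" if "s \<in> {0..t}" for s
      using that deriv by (intro fundamental_theorem_of_calculus) auto
  qed
qed

text \<open>The initial states agree, so all terms cancel except the one of highest degree, which
  carries the control.\<close>

lemma const_trajectory_diff:
  fixes x :: "real^'n::{finite,linorder}"
  shows "(const_trajectory c x s - const_trajectory c' x s) $ i
    = (c - c') * (s ^ (Suc CARD('n) - pos i) / fact (Suc CARD('n) - pos i))"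
proof -
  let ?N = "Suc CARD('n) - pos i"
  have N: "?N = Suc (CARD('n) - pos i)" "pos i + ?N = Suc CARD('n)"
    using pos_le_card[of i] by simp_all
  have "(const_trajectory c x s - const_trajectory c' x s) $ i
      = (\<Sum>k\<le>?N. s ^ k / fact k * (extended_state c x (pos i + k) - extended_state c' x (pos i + k)))"
    by (simp add: const_trajectory_def taylor_tail_def sum_subtractf right_diff_distrib)
  also have "\<dots> = (\<Sum>k\<in>{?N}. s ^ k / fact k * (c - c'))"
    using N by (intro sum.mono_neutral_cong_right) (auto simp: extended_state_def)
  finally show ?thesis by (simp add: mult.commute)
qed

text \<open>The exponent is written as in \<open>const_trajectory_diff\<close>, so that the
  difference of two end points is visibly a multiple of \<open>zeta t\<close>.\<close>

lemma zeta_nth: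
  assumes "t \<ge> 0"
  shows "(zeta t :: real^'n::{finite,linorder}) $ i
    = t ^ (Suc CARD('n) - pos i) / fact (Suc CARD('n) - pos i)"
proof -
  let ?n = "\<lambda>i::'n. CARD('n) - pos i"
  have "(xi has_integral (\<chi> i. t ^ Suc (?n i) / fact (Suc (?n i)))) {0..t}"
  proof (subst has_integral_componentwise_iff, intro ballI)
    fix b :: "real^'n::{finite,linorder}" assume "b \<in> Basis"
    then obtain i where b: "b = axis i 1" by (auto simp: Basis_vec_def)
    have "((\<lambda>s. s ^ ?n i / fact (?n i)) has_integral
        (t ^ Suc (?n i) / fact (Suc (?n i)) - 0 ^ Suc (?n i) / fact (Suc (?n i)))) {0..t}"
      using assms
      by (intro fundamental_theorem_of_calculus)
        (simp_all only: has_real_derivative_iff_has_vector_derivative[symmetric] DERIV_power_div_fact)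
    then show "((\<lambda>s. xi s \<bullet> b) has_integral (\<chi> i. t ^ Suc (?n i) / fact (Suc (?n i))) \<bullet> b) {0..t}"
      by (simp add: b inner_axis xi_def)
  qed
  then show ?thesis
    by (simp add: zeta_def integral_unique Suc_diff_le pos_le_card)
qed

lemma norm_zeta:
  assumes "t \<ge> 0"
  shows "norm (zeta t :: real^'n::{finite,linorder}) = sqrt (\<Sum>j=1..CARD('n). (t ^ j / fact j)\<^sup>2)"
proof -
  let ?f = "\<lambda>j. (t ^ j / fact j)\<^sup>2"
  have "(\<Sum>i\<in>UNIV. ?f (Suc CARD('n) - pos (i :: 'n))) = (\<Sum>m=1..CARD('n). ?f (Suc CARD('n) - m))"
    by (rule sum.reindex_bij_betw[OF bij_betw_pos])
  \<comment> \<open>Powers decrease along the coordinates, so the sum is reversed.\<close>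
  also have "\<dots> = sum ?f {1..CARD('n)}"
    using sum.atLeastAtMost_rev[of ?f 1 "CARD('n)"] by simp
  finally show ?thesis
    by (simp only: norm_vec_def L2_set_def zeta_nth[OF assms] real_norm_def power2_abs)
qed

theorem theorem2:
  fixes x\<^sub>0 :: "real^'n::{finite,linorder}" and d :: nat and \<mu> t :: real
  assumes "CARD('n) = d" and "d \<ge> 2" and "\<mu> > 0" and "t > 0"
  shows "diam (reach_set \<mu> {x\<^sub>0} t) = 2 * \<mu> * norm (zeta t :: real^'n::{finite,linorder}) \<and>
         2 * \<mu> * norm (zeta t :: real^'n::{finite,linorder}) = 2 * \<mu> * sqrt (\<Sum>j=1..d. (t ^ j / fact j)\<^sup>2)"
proof
  let ?R = "reach_set \<mu> {x\<^sub>0} t"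
  define p where "p = const_trajectory \<mu> x\<^sub>0 t"
  define q where "q = const_trajectory (- \<mu>) x\<^sub>0 t"
  have reach: "const_trajectory c x\<^sub>0 t \<in> ?R" if "c \<in> {-\<mu>..\<mu>}" for c
    unfolding reach_set_def admissible_control_def using that
    by (intro CollectI exI[of _ "const_trajectory c x\<^sub>0"] exI[of _ "\<lambda>_. c"])
      (simp add: integrator_solution_const_trajectory)
  have box: "q $ i \<le> x $ i \<and> x $ i \<le> p $ i" if x: "x \<in> ?R" for x i
  proof -
    obtain z u where u: "admissible_control \<mu> t u"
      and z: "integrator_solution t u z" "z 0 = x\<^sub>0" "x = z t"
      using x unfolding reach_set_def by blast
    have u: "u s \<in> {-\<mu>..\<mu>}" if "s \<in> {0..t}" for s
      using u that by (simp add: admissible_control_def)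
    have "q $ i \<le> z t $ i"
      unfolding q_def
      by (rule integrator_solution_mono[OF integrator_solution_const_trajectory z(1)])
        (use u z \<open>t > 0\<close> in auto)
    moreover have "z t $ i \<le> p $ i"
      unfolding p_def
      by (rule integrator_solution_mono[OF z(1) integrator_solution_const_trajectory])
        (use u z \<open>t > 0\<close> in auto)
    ultimately show ?thesis by (simp add: z)
  qed
  have pq: "p - q = (2 * \<mu>) *\<^sub>R zeta t"
    unfolding vec_eq_iff p_def q_def const_trajectory_diff vector_scaleR_component
    using \<open>t > 0\<close> by (simp add: zeta_nth)
  \<comment> \<open>Here \<open>undefined\<close> is just some index; every coordinate of
    \<open>zeta t\<close> is positive.\<close>
  have "zeta t $ (undefined :: 'n) \<noteq> 0"
    using \<open>t > 0\<close> by (simp add: zeta_nth)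
  then have "zeta t \<noteq> (0 :: real^'n::{finite,linorder})" by (metis zero_index)
  then have "p - q \<noteq> 0" unfolding pq using \<open>\<mu> > 0\<close> by simp
  then have "p \<noteq> q" by simp
  have "diam ?R = dist p q"
  proof (rule diam_eq_dist[OF _ _ \<open>p \<noteq> q\<close>])
    show "p \<in> ?R" "q \<in> ?R" unfolding p_def q_def using \<open>\<mu> > 0\<close> by (auto intro: reach)
    fix x y assume "x \<in> ?R" "y \<in> ?R"
    \<comment> \<open>Both points lie in the box between \<open>q\<close> and \<open>p\<close>, so
      their coordinates differ by at most its side lengths.\<close>
    then have "norm ((x - y) $ i) \<le> norm ((p - q) $ i)" for i
      using box[of x i] box[of y i] by (simp add: abs_le_iff)
    then show "dist x y \<le> dist p q" unfolding dist_norm by (rule norm_le_componentwise_cart)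
  qed
  then show "diam ?R = 2 * \<mu> * norm (zeta t :: real^'n::{finite,linorder})"
    using \<open>\<mu> > 0\<close> by (simp add: dist_norm pq)
  show "2 * \<mu> * norm (zeta t :: real^'n::{finite,linorder}) = 2 * \<mu> * sqrt (\<Sum>j=1..d. (t ^ j / fact j)\<^sup>2)"
    using assms by (simp add: norm_zeta)
qed

end
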